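(* Let $A\in\mathbb{R}^{m\times n}$ be a matrix of full column rank, let $b\in\mathbb{R}^{m}$, and let $x_{\star}=A^{\dagger}b$ be the minimum Euclidean norm least squares solution of $\min_{x\in\mathbb{R}^n}\|b-Ax\|_2^2$. Let $A=U\Sigma V^T$ be a singular value decomposition with left singular vectors $u_1,\dots,u_m$ and singular values $\sigma_1(A)\ge\sigma_2(A)\ge\cdots$. Let $x_k$ be the $k$th approximation generated by the randomized Gauss--Seidel (RGS) method with (deterministic) initial guess $x_0\in\mathbb{R}^n$. Then for every $k\ge 0$ and every $\ell\in\{1,\dots,\min\{m,n\}\}$, $$\mathbb{E}\big[\langle Ax_k-Ax_{\star},u_\ell\rangle\big]=\Big(1-\frac{\sigma_\ell^2(A)}{\|A\|_F^2}\Big)^k\langle Ax_0-Ax_{\star},u_\ell\rangle .$$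
   Context: Notation: $A_{(j)}$ is the $j$th column of $A$, $e_{(j)}$ is the $j$th column of the $n\times n$ identity matrix, $\|A\|_F$ is the Frobenius norm, $A^{\dagger}$ is the Moore--Penrose pseudoinverse, $\langle\cdot,\cdot\rangle$ is the Euclidean inner product, $\sigma_i(A)$ is the $i$th singular value of $A$. Singular value decomposition: $A=U\Sigma V^T$ with $U=[u_1,\dots,u_m]\in\mathbb{R}^{m\times m}$ and $V=[v_1,\dots,v_n]\in\mathbb{R}^{n\times n}$ orthogonal, and $\Sigma\in\mathbb{R}^{m\times n}$ diagonal with diagonal entries $\sigma_1(A)\ge\sigma_2(A)\ge\cdots$ in nonincreasing order; $u_i$, $v_i$ are the left and right singular vectors. RGS method: starting from $x_0\in\mathbb{R}^n$, for $k=1,2,\dots$, select an index $j\in\{1,\dots,n\}$, independently of the previous selections, with probability $\|A_{(j)}\|_2^2/\|A\|_F^2$, and set $$x_k=x_{k-1}-\frac{A_{(j)}^T(Ax_{k-1}-b)}{\|A_{(j)}\|_2^2}\,e_{(j)} .$$ $\mathbb{E}$ is the expectation over all random selections. *)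

theory Defs
  imports
    "HOL-Probability.Independent_Family"
    "Jordan_Normal_Form.DL_Rank"
begin

(* The analysis library uses the same symbols for its own inner product and vector
   component; here they denote the operations of Jordan_Normal_Form.Matrix. *)
no_notation Inner_Product.real_inner_class.inner (infix "\<bullet>" 70)
no_notation Finite_Cartesian_Product.vec_nth (infixl "$" 90)

definition eucl_norm :: "real vec \<Rightarrow> real" where
  "eucl_norm v = sqrt (v \<bullet> v)"

definition frob_norm :: "real mat \<Rightarrow> real" where
  "frob_norm A = sqrt (\<Sum>i<dim_row A. \<Sum>j<dim_col A. (A $$ (i, j))\<^sup>2)"

text \<open>The four Penrose conditions.\<close>

definition is_pinv :: "real mat \<Rightarrow> real mat \<Rightarrow> bool" where
  "is_pinv A X \<longleftrightarrow>
     X \<in> carrier_mat (dim_col A) (dim_row A) \<and>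
     A * X * A = A \<and>
     X * A * X = X \<and>
     transpose_mat (A * X) = A * X \<and>
     transpose_mat (X * A) = X * A"

definition pinv :: "real mat \<Rightarrow> real mat" where
  "pinv A = (THE X. is_pinv A X)"

text \<open>The library's \<^const>\<open>orthogonal_mat\<close> only asks for pairwise orthogonal nonzero columns,
  so orthonormality is stated explicitly. For a rectangular matrix, \<^const>\<open>diagonal_mat\<close> means
  that all entries \<open>(i, j)\<close> with \<open>i \<noteq> j\<close> vanish. Indices start at 0: the singular value with
  (one-based) number \<open>l + 1\<close> is \<open>S $$ (l, l)\<close>, and its left singular vector is \<open>col U l\<close>.\<close>

definition is_svd :: "real mat \<Rightarrow> real mat \<Rightarrow> real mat \<Rightarrow> real mat \<Rightarrow> bool" where
  "is_svd A U S V \<longleftrightarrow>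
     (let m = dim_row A; n = dim_col A in
       U \<in> carrier_mat m m \<and> transpose_mat U * U = 1\<^sub>m m \<and> U * transpose_mat U = 1\<^sub>m m \<and>
       V \<in> carrier_mat n n \<and> transpose_mat V * V = 1\<^sub>m n \<and> V * transpose_mat V = 1\<^sub>m n \<and>
       S \<in> carrier_mat m n \<and> diagonal_mat S \<and>
       (\<forall>i < min m n. 0 \<le> S $$ (i, i)) \<and>
       (\<forall>i j. i \<le> j \<and> j < min m n \<longrightarrow> S $$ (j, j) \<le> S $$ (i, i)) \<and>
       A = U * S * transpose_mat V)"

definition rgs_step :: "real mat \<Rightarrow> real vec \<Rightarrow> nat \<Rightarrow> real vec \<Rightarrow> real vec" where
  "rgs_step A b j x =
     x - ((col A j \<bullet> (A *\<^sub>v x - b)) / (eucl_norm (col A j))\<^sup>2) \<cdot>\<^sub>v unit_vec (dim_col A) j"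

text \<open>The iterates for a given sequence \<open>j 1, j 2, \<dots>\<close> of selected columns; \<open>j 0\<close> is not used.\<close>

primrec rgs :: "real mat \<Rightarrow> real vec \<Rightarrow> real vec \<Rightarrow> (nat \<Rightarrow> nat) \<Rightarrow> nat \<Rightarrow> real vec" where
  "rgs A b x0 j 0 = x0"
| "rgs A b x0 j (Suc k) = rgs_step A b (j (Suc k)) (rgs A b x0 j k)"

text \<open>\<open>J k\<close> is the column selected in step \<open>k \<ge> 1\<close>, as a random variable on an arbitrary
  probability space; independence includes measurability into \<open>{..<dim_col A}\<close>.\<close>

locale rgs_selection = prob_space M for M :: "'a measure" +
  fixes A :: "real mat" and J :: "nat \<Rightarrow> 'a \<Rightarrow> nat"
  assumes indep: "indep_vars (\<lambda>_. count_space {..<dim_col A}) J {1..}"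
    and prob_select: "\<And>k j. k \<ge> 1 \<Longrightarrow> j < dim_col A \<Longrightarrow>
      prob {\<omega> \<in> space M. J k \<omega> = j} = (eucl_norm (col A j))\<^sup>2 / (frob_norm A)\<^sup>2"

end

theory Submission
  imports Defs
begin

text \<open>Let \<open>r = A x - A z\<close>, where \<open>z\<close> is the pseudoinverse solution. Selecting column \<open>j\<close> subtracts
  from \<open>A x\<close> the orthogonal projection of \<open>A x - b\<close> onto that column \<open>a\<^sub>j\<close>, that is
  \<open>(a\<^sub>j \<bullet> (A x - b)) / \<parallel>a\<^sub>j\<parallel>\<^sup>2 \<cdot> a\<^sub>j\<close>. The selection probability \<open>\<parallel>a\<^sub>j\<parallel>\<^sup>2 / \<parallel>A\<parallel>\<^sub>F\<^sup>2\<close> is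
  proportional to exactly the denominator, so the denominators cancel in the mean and the average
  correction is \<open>A A\<^sup>T (A x - b) / \<parallel>A\<parallel>\<^sub>F\<^sup>2\<close>. Since \<open>z\<close> solves the normal equations
  \<open>A\<^sup>T A z = A\<^sup>T b\<close>, this equals \<open>A A\<^sup>T r / \<parallel>A\<parallel>\<^sub>F\<^sup>2\<close>: on average one step applies the symmetric
  linear map \<open>I - A A\<^sup>T / \<parallel>A\<parallel>\<^sub>F\<^sup>2\<close> to \<open>r\<close>. The left singular vector \<open>u\<^sub>l\<close> is an eigenvector of this map
  with eigenvalue \<open>1 - \<sigma>\<^sub>l\<^sup>2 / \<parallel>A\<parallel>\<^sub>F\<^sup>2\<close>, so the mean of \<open>r \<bullet> u\<^sub>l\<close> is multiplied by this number in every
  step (lemma \<open>rgs_step_average\<close>).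

  Two things make this rigorous. The pseudoinverse is defined by a definite description, so
  its existence and uniqueness have to be established before the normal equations can be
  derived from the Penrose conditions (\<open>is_svd_imp_ex_pinv\<close>, \<open>is_pinv_unique\<close>,
  \<open>is_pinv_normal_equations\<close>). And the one-step average has to be taken conditionally on the current
  iterate: that iterate is a function of the finitely-valued tuple of past selections, which is
  independent of the next selection, so the next selection can be averaged out first
  (\<open>expectation_next\<close>).\<close>

section \<open>The pseudoinverse of a matrix with a singular value decomposition\<close>

text \<open>Changing coordinates by orthogonal matrices is compatible with products and transposes.
  Therefore the Penrose conditions need to be checked only for the diagonal factor of a singular
  value decomposition.\<close>

lemma orthogonal_sandwich_mult:
  fixes P X Q Y R :: "real mat"
  assumes "P \<in> carrier_mat a a" "X \<in> carrier_mat a b" "Q \<in> carrier_mat b b"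
    and "Y \<in> carrier_mat b c" "R \<in> carrier_mat c c"
    and orth: "transpose_mat Q * Q = 1\<^sub>m b"
  shows "(P * X * transpose_mat Q) * (Q * Y * transpose_mat R) = P * (X * Y) * transpose_mat R"
proof -
  let ?Qt = "transpose_mat Q" and ?Rt = "transpose_mat R"
  have c: "?Qt \<in> carrier_mat b b" "?Rt \<in> carrier_mat c c" "P * X \<in> carrier_mat a b"
    "Y * ?Rt \<in> carrier_mat b c" "Q * (Y * ?Rt) \<in> carrier_mat b c"
    using assms by auto
  have "(P * X * ?Qt) * (Q * Y * ?Rt) = P * X * (?Qt * (Q * (Y * ?Rt)))"
    unfolding assoc_mult_mat[OF assms(3,4) c(2)] by (rule assoc_mult_mat[OF c(3,1,5)])
  also have "?Qt * (Q * (Y * ?Rt)) = Y * ?Rt"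
    unfolding assoc_mult_mat[OF c(1) assms(3) c(4), symmetric] orth
    by (rule left_mult_one_mat[OF c(4)])
  also have "P * X * (Y * ?Rt) = P * (X * (Y * ?Rt))"
    by (rule assoc_mult_mat[OF assms(1,2) c(4)])
  also have "\<dots> = P * (X * Y * ?Rt)"
    unfolding assoc_mult_mat[OF assms(2,4) c(2)] ..
  also have "\<dots> = P * (X * Y) * ?Rt"
    using assms(2,4) by (intro assoc_mult_mat[OF assms(1) _ c(2), symmetric]) simp
  finally show ?thesis .
qed

lemma orthogonal_sandwich_transpose:
  fixes P X Q :: "real mat"
  assumes "P \<in> carrier_mat a a" "X \<in> carrier_mat a b" "Q \<in> carrier_mat b b"
  shows "transpose_mat (P * X * transpose_mat Q) = Q * transpose_mat X * transpose_mat P"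
proof -
  have "transpose_mat (P * X * transpose_mat Q) = Q * transpose_mat (P * X)"
    using assms by (subst transpose_mult[where nr=a and n=b and nc=b]) auto
  also have "\<dots> = Q * (transpose_mat X * transpose_mat P)"
    using assms by (subst transpose_mult[where nr=a and n=a and nc=b]) auto
  also have "\<dots> = Q * transpose_mat X * transpose_mat P"
    using assms by (subst assoc_mult_mat[of _ b b _ a _ a]) auto
  finally show ?thesis .
qed

lemma is_pinv_orthogonal_sandwich:
  assumes U: "U \<in> carrier_mat m m" "transpose_mat U * U = 1\<^sub>m m"
    and V: "V \<in> carrier_mat n n" "transpose_mat V * V = 1\<^sub>m n"
    and S: "S \<in> carrier_mat m n" and T: "is_pinv S T"
  shows "is_pinv (U * S * transpose_mat V) (V * T * transpose_mat U)"
proof -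
  have Tc: "T \<in> carrier_mat n m" and pen: "S * T * S = S" "T * S * T = T"
    "transpose_mat (S * T) = S * T" "transpose_mat (T * S) = T * S"
    using T S unfolding is_pinv_def by auto
  have c: "S * T \<in> carrier_mat m m" "T * S \<in> carrier_mat n n" using S Tc by auto
  note mult = orthogonal_sandwich_mult and trans = orthogonal_sandwich_transpose
  have AX: "(U * S * transpose_mat V) * (V * T * transpose_mat U) = U * (S * T) * transpose_mat U"
    by (rule mult[OF U(1) S V(1) Tc U(1) V(2)])
  have XA: "(V * T * transpose_mat U) * (U * S * transpose_mat V) = V * (T * S) * transpose_mat V"
    by (rule mult[OF V(1) Tc U(1) S V(1) U(2)])
  show ?thesis
    unfolding is_pinv_def AX XA
      mult[OF U(1) c(1) U(1) S V(1) U(2)] mult[OF V(1) c(2) V(1) Tc U(1) V(2)]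
      trans[OF U(1) c(1) U(1)] trans[OF V(1) c(2) V(1)] pen
    using U V S Tc by auto
qed

text \<open>Rectangular diagonal matrices given by a total function: products and transposes are
  again of this form for all dimensions, and identities between them reduce to identities between
  the entries.\<close>

definition rect_diag :: "nat \<Rightarrow> nat \<Rightarrow> (nat \<Rightarrow> real) \<Rightarrow> real mat" where
  "rect_diag m n d = mat m n (\<lambda>(i, j). if i = j then d i else 0)"

lemma rect_diag_transpose: "transpose_mat (rect_diag m n d) = rect_diag n m d"
  by (rule eq_matI) (auto simp: rect_diag_def)

lemma rect_diag_cong:
  "(\<And>i. i < m \<Longrightarrow> i < n \<Longrightarrow> d i = e i) \<Longrightarrow> rect_diag m n d = rect_diag m n e"
  by (rule eq_matI) (auto simp: rect_diag_def)

lemma rect_diag_mult: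
  "rect_diag a b d * rect_diag b c e = rect_diag a c (\<lambda>i. if i < b then d i * e i else 0)"
  (is "?L = ?R")
proof (rule eq_matI)
  fix i j assume "i < dim_row ?R" "j < dim_col ?R"
  then have ij: "i < a" "j < c" by (auto simp: rect_diag_def)
  then have "?L $$ (i, j) = (\<Sum>k = 0..<b. (if i = k then d i else 0) * (if k = j then e k else 0))"
    by (simp add: rect_diag_def scalar_prod_def)
  also have "\<dots> = (\<Sum>k = 0..<b. if k = i then (if i = j then d i * e i else 0) else 0)"
    by (rule sum.cong) auto
  also have "\<dots> = ?R $$ (i, j)"
    using ij by (subst sum.delta) (auto simp: rect_diag_def)
  finally show "?L $$ (i, j) = ?R $$ (i, j)" .
qed (auto simp: rect_diag_def)

lemma diagonal_mat_eq_rect_diag: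
  assumes "S \<in> carrier_mat m n" "diagonal_mat S"
  shows "S = rect_diag m n (\<lambda>i. S $$ (i, i))"
  using assms by (intro eq_matI) (auto simp: rect_diag_def diagonal_mat_def)

text \<open>The convention \<open>inverse 0 = 0\<close> makes \<open>inverse\<close> the pseudoinverse on scalars, so it also
  treats the vanishing diagonal entries correctly.\<close>

lemma is_pinv_rect_diag: "is_pinv (rect_diag m n d) (rect_diag n m (\<lambda>i. inverse (d i)))"
proof -
  let ?S = "rect_diag m n d" and ?T = "rect_diag n m (\<lambda>i. inverse (d i))"
  have inv: "d i * inverse (d i) * d i = d i"
    "inverse (d i) * d i * inverse (d i) = inverse (d i)" for i
    by (cases "d i = 0"; simp)+
  have "?S * ?T * ?S = ?S" "?T * ?S * ?T = ?T"
    unfolding rect_diag_mult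
    by (rule rect_diag_cong; simp only: if_True inv)+
  moreover have "transpose_mat (?S * ?T) = ?S * ?T" "transpose_mat (?T * ?S) = ?T * ?S"
    unfolding rect_diag_mult rect_diag_transpose by (rule refl)+
  ultimately show ?thesis
    unfolding is_pinv_def by (simp add: rect_diag_def)
qed

lemma is_svdD:
  assumes "is_svd A U S V" and "A \<in> carrier_mat m n"
  shows "U \<in> carrier_mat m m" "transpose_mat U * U = 1\<^sub>m m"
    and "V \<in> carrier_mat n n" "transpose_mat V * V = 1\<^sub>m n"
    and "S \<in> carrier_mat m n" "diagonal_mat S" and "A = U * S * transpose_mat V"
  using assms(1) unfolding is_svd_def Let_def carrier_matD[OF assms(2)] by simp_all

lemma is_svd_imp_ex_pinv:
  assumes "is_svd A U S V"
  shows "\<exists>X. is_pinv A X"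
proof -
  have "A \<in> carrier_mat (dim_row A) (dim_col A)" by simp
  note svd = is_svdD[OF assms this]
  have "is_pinv S (rect_diag (dim_col A) (dim_row A) (\<lambda>i. inverse (S $$ (i, i))))"
    using is_pinv_rect_diag[of "dim_row A" "dim_col A" "\<lambda>i. S $$ (i, i)"]
    unfolding diagonal_mat_eq_rect_diag[OF svd(5,6), symmetric] .
  from is_pinv_orthogonal_sandwich[OF svd(1-5) this] show ?thesis
    unfolding svd(7)[symmetric] by (rule exI)
qed

text \<open>\<open>A X\<close> and \<open>A Y\<close> are symmetric and satisfy \<open>(A Y) (A X) = A X\<close> and \<open>(A X) (A Y) = A Y\<close>. Transposing
  one of these identities exchanges its two factors, and hence the two matrices agree. Both are
  the orthogonal projection onto the range of \<open>A\<close>; likewise for \<open>X A\<close> and \<open>Y A\<close> on the row space.\<close>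

lemma is_pinv_projections_eq:
  assumes X: "is_pinv A X" and Y: "is_pinv A Y"
  shows "A * X = A * Y" and "X * A = Y * A"
proof -
  let ?m = "dim_row A" and ?n = "dim_col A"
  have c: "A \<in> carrier_mat ?m ?n" "X \<in> carrier_mat ?n ?m" "Y \<in> carrier_mat ?n ?m"
    using X Y by (auto simp: is_pinv_def)
  have pX: "A * X * A = A" "transpose_mat (A * X) = A * X" "transpose_mat (X * A) = X * A"
    and pY: "A * Y * A = A" "transpose_mat (A * Y) = A * Y" "transpose_mat (Y * A) = Y * A"
    using X Y by (auto simp: is_pinv_def)
  have cc: "A * X \<in> carrier_mat ?m ?m" "A * Y \<in> carrier_mat ?m ?m"
    "X * A \<in> carrier_mat ?n ?n" "Y * A \<in> carrier_mat ?n ?n" using c by auto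
  have "(A * Y) * (A * X) = A * X"
    unfolding assoc_mult_mat[OF cc(2) c(1,2), symmetric] pY(1) ..
  moreover have "(A * X) * (A * Y) = A * Y"
    unfolding assoc_mult_mat[OF cc(1) c(1,3), symmetric] pX(1) ..
  ultimately show "A * X = A * Y"
    using transpose_mult[OF cc(2) cc(1)] pX(2) pY(2) by simp
  have "(X * A) * (Y * A) = X * A"
    unfolding assoc_mult_mat[OF c(2,1) cc(4)] assoc_mult_mat[OF c(1,3,1), symmetric] pY(1) ..
  moreover have "(Y * A) * (X * A) = Y * A"
    unfolding assoc_mult_mat[OF c(3,1) cc(3)] assoc_mult_mat[OF c(1,2,1), symmetric] pX(1) ..
  ultimately show "X * A = Y * A"
    using transpose_mult[OF cc(3) cc(4)] pX(3) pY(3) by simp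
qed

lemma is_pinv_unique:
  assumes X: "is_pinv A X" and Y: "is_pinv A Y"
  shows "X = Y"
proof -
  have c: "A \<in> carrier_mat (dim_row A) (dim_col A)" "X \<in> carrier_mat (dim_col A) (dim_row A)"
    "Y \<in> carrier_mat (dim_col A) (dim_row A)"
    using X Y by (auto simp: is_pinv_def)
  have "X = X * A * X" using X by (simp add: is_pinv_def)
  also have "\<dots> = Y * A * X" by (simp only: is_pinv_projections_eq(2)[OF X Y])
  also have "\<dots> = Y * (A * X)" using c by (rule_tac assoc_mult_mat) auto
  also have "\<dots> = Y * (A * Y)" by (simp only: is_pinv_projections_eq(1)[OF X Y])
  also have "\<dots> = Y * A * Y" using c by (rule_tac assoc_mult_mat[symmetric]) auto
  also have "\<dots> = Y" using Y by (simp add: is_pinv_def)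
  finally show ?thesis .
qed

lemma is_pinv_pinv:
  assumes "is_pinv A X"
  shows "is_pinv A (pinv A)"
  unfolding pinv_def using assms is_pinv_unique by (blast intro: theI)

text \<open>Transposing \<open>A X A = A\<close> and using the symmetry of \<open>A X\<close> gives \<open>A\<^sup>T A X = A\<^sup>T\<close>.\<close>

lemma is_pinv_normal_equations:
  assumes A: "A \<in> carrier_mat m n" and X: "is_pinv A X" and b: "b \<in> carrier_vec m"
  shows "transpose_mat A *\<^sub>v (A *\<^sub>v (X *\<^sub>v b)) = transpose_mat A *\<^sub>v b"
proof -
  have Xc: "X \<in> carrier_mat n m" and AX: "A * X \<in> carrier_mat m m"
    using A X by (auto simp: is_pinv_def)
  have "transpose_mat A = transpose_mat (A * X * A)" using X by (simp add: is_pinv_def)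
  also have "\<dots> = transpose_mat A * (A * X)"
    using X transpose_mult[OF AX A] by (simp add: is_pinv_def)
  finally have "transpose_mat A *\<^sub>v b = transpose_mat A * (A * X) *\<^sub>v b" by simp
  also have "\<dots> = transpose_mat A *\<^sub>v ((A * X) *\<^sub>v b)"
    using A AX b by (intro assoc_mult_mat_vec) auto
  also have "(A * X) *\<^sub>v b = A *\<^sub>v (X *\<^sub>v b)"
    using A Xc b by (rule assoc_mult_mat_vec)
  finally show ?thesis by simp
qed

section \<open>Singular vectors\<close>

lemma is_svd_mult_right_singular_vector:
  assumes svd: "is_svd A U S V" and A: "A \<in> carrier_mat m n" and l: "l < m" "l < n"
  shows "A *\<^sub>v col V l = S $$ (l, l) \<cdot>\<^sub>v col U l"
proof -
  note d = is_svdD[OF svd A]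
  have "A * V = U * S * transpose_mat V * V"
    by (simp only: d(7)[symmetric])
  also have "\<dots> = U * S * (transpose_mat V * V)"
    using d(1,3,5) by (intro assoc_mult_mat) auto
  also have "\<dots> = U * S"
    unfolding d(4) using d(1,5) by (intro right_mult_one_mat) auto
  finally have AV: "A * V = U * S" .
  have "A *\<^sub>v col V l = col (A * V) l"
    by (rule col_mult2[OF A d(3) l(2), symmetric])
  also have "\<dots> = U *\<^sub>v col S l"
    unfolding AV by (rule col_mult2[OF d(1,5) l(2)])
  also have "col S l = S $$ (l, l) \<cdot>\<^sub>v unit_vec m l"
    using d(5,6) l by (intro eq_vecI) (auto simp: diagonal_mat_def unit_vec_def)
  also have "U *\<^sub>v (S $$ (l, l) \<cdot>\<^sub>v unit_vec m l) = S $$ (l, l) \<cdot>\<^sub>v (U *\<^sub>v unit_vec m l)"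
    by (rule mult_mat_vec[OF d(1)]) simp
  also have "U *\<^sub>v unit_vec m l = col U l"
    using d(1) l by (intro eq_vecI) auto
  finally show ?thesis .
qed

text \<open>Exchanges the roles of left and right singular vectors, so that the identity
  \<open>A\<^sup>T u\<^sub>l = \<sigma>\<^sub>l v\<^sub>l\<close> is an instance of \<open>A v\<^sub>l = \<sigma>\<^sub>l u\<^sub>l\<close>.\<close>

lemma is_svd_transpose:
  assumes "is_svd A U S V"
  shows "is_svd (transpose_mat A) V (transpose_mat S) U"
proof -
  obtain m n where A: "A \<in> carrier_mat m n"
    using carrier_matI by blast
  note d = is_svdD[OF assms A]
  have At: "transpose_mat A = V * transpose_mat S * transpose_mat U"
    using orthogonal_sandwich_transpose[OF d(1,5,3)] unfolding d(7)[symmetric] .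
  have "diagonal_mat (transpose_mat S)" "min n m = min m n"
    using d(6) by (auto simp: diagonal_mat_def)
  moreover have "transpose_mat S $$ (i, i) = S $$ (i, i)" if "i < min m n" for i
    using d(5) that by auto
  ultimately show ?thesis
    using assms d(5)
    unfolding is_svd_def Let_def index_transpose_mat(2,3) carrier_matD[OF A] At[symmetric]
    by simp
qed

lemma is_svd_left_singular_vector_eigen:
  assumes svd: "is_svd A U S V" and A: "A \<in> carrier_mat m n" and l: "l < m" "l < n"
  shows "A *\<^sub>v (transpose_mat A *\<^sub>v col U l) = (S $$ (l, l))\<^sup>2 \<cdot>\<^sub>v col U l"
proof -
  have V: "col V l \<in> carrier_vec n" and S: "S \<in> carrier_mat m n"
    using is_svdD(3,5)[OF svd A] l by auto
  have At: "transpose_mat A \<in> carrier_mat n m" using A by simp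
  have "transpose_mat A *\<^sub>v col U l = S $$ (l, l) \<cdot>\<^sub>v col V l"
    using is_svd_mult_right_singular_vector[OF is_svd_transpose[OF svd] At l(2,1)] S l by simp
  then have "A *\<^sub>v (transpose_mat A *\<^sub>v col U l) = S $$ (l, l) \<cdot>\<^sub>v (A *\<^sub>v col V l)"
    using mult_mat_vec[OF A V] by simp
  also have "A *\<^sub>v col V l = S $$ (l, l) \<cdot>\<^sub>v col U l"
    by (rule is_svd_mult_right_singular_vector[OF svd A l])
  finally show ?thesis by (simp add: smult_smult_assoc power2_eq_square)
qed

section \<open>One step of the method\<close>

lemma rgs_step_carrier:
  assumes "A \<in> carrier_mat m n" "x \<in> carrier_vec n"
  shows "rgs_step A b j x \<in> carrier_vec n"
  using assms by (auto simp: rgs_step_def)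

lemma rgs_carrier:
  assumes "A \<in> carrier_mat m n" "x0 \<in> carrier_vec n"
  shows "rgs A b x0 f k \<in> carrier_vec n"
  using assms by (induction k) (auto intro: rgs_step_carrier)

lemma rgs_cong:
  "(\<And>i. i \<in> {1..k} \<Longrightarrow> f i = g i) \<Longrightarrow> rgs A b x0 f k = rgs A b x0 g k"
  by (induction k) auto

lemma rgs_step_residual_component:
  assumes A: "A \<in> carrier_mat m n" and x: "x \<in> carrier_vec n" and y: "y \<in> carrier_vec m"
    and u: "u \<in> carrier_vec m" and j: "j < n"
  shows "(A *\<^sub>v rgs_step A b j x - y) \<bullet> u
    = (A *\<^sub>v x - y) \<bullet> u
      - (col A j \<bullet> (A *\<^sub>v x - b)) / (eucl_norm (col A j))\<^sup>2 * (col A j \<bullet> u)"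
proof -
  define c where "c = (col A j \<bullet> (A *\<^sub>v x - b)) / (eucl_norm (col A j))\<^sup>2"
  have e: "A *\<^sub>v unit_vec n j = col A j"
    using A j by (intro eq_vecI) auto
  have Ax: "A *\<^sub>v x \<in> carrier_vec m" and a: "col A j \<in> carrier_vec m" using A x by auto
  have "A *\<^sub>v rgs_step A b j x = A *\<^sub>v x - A *\<^sub>v (c \<cdot>\<^sub>v unit_vec n j)"
    using A x by (simp add: rgs_step_def c_def mult_minus_distrib_mat_vec[OF A])
  also have "\<dots> = A *\<^sub>v x - c \<cdot>\<^sub>v col A j"
    by (simp add: mult_mat_vec[OF A] e)
  finally show ?thesis
    using Ax a y u unfolding c_def[symmetric]
    by (simp add: minus_scalar_prod_distrib[where n=m])
qed

text \<open>The weight of column \<open>j\<close> cancels the squared norm in the step length, which leaves the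
  correction \<open>\<Sum>\<^sub>j (a\<^sub>j \<bullet> (A x - b)) (a\<^sub>j \<bullet> u) = (A\<^sup>T (A x - b)) \<bullet> (A\<^sup>T u)\<close>. The normal equations replace
  \<open>b\<close> by \<open>A z\<close>, and moving \<open>A\<^sup>T\<close> to the other side of the inner product turns the sum into
  \<open>(A x - A z) \<bullet> (A A\<^sup>T u)\<close>, where the eigenvector property applies.\<close>

lemma rgs_step_average:
  assumes A: "A \<in> carrier_mat m n" and b: "b \<in> carrier_vec m"
    and x: "x \<in> carrier_vec n" and z: "z \<in> carrier_vec n" and u: "u \<in> carrier_vec m"
    and normal: "transpose_mat A *\<^sub>v (A *\<^sub>v z) = transpose_mat A *\<^sub>v b"
    and eigen: "A *\<^sub>v (transpose_mat A *\<^sub>v u) = c \<cdot>\<^sub>v u"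
    and prob: "(\<Sum>j<n. (eucl_norm (col A j))\<^sup>2 / (frob_norm A)\<^sup>2) = 1"
  shows "(\<Sum>j<n. (eucl_norm (col A j))\<^sup>2 / (frob_norm A)\<^sup>2
            * ((A *\<^sub>v rgs_step A b j x - A *\<^sub>v z) \<bullet> u))
    = (1 - c / (frob_norm A)\<^sup>2) * ((A *\<^sub>v x - A *\<^sub>v z) \<bullet> u)"
proof -
  let ?F = "(frob_norm A)\<^sup>2" and ?a = "col A" and ?At = "transpose_mat A"
  let ?r = "(A *\<^sub>v x - A *\<^sub>v z) \<bullet> u" and ?w = "A *\<^sub>v x - b"
  have Ax: "A *\<^sub>v x \<in> carrier_vec m" and Az: "A *\<^sub>v z \<in> carrier_vec m"
    and At: "?At \<in> carrier_mat n m" and w: "?w \<in> carrier_vec m"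
    and Atu: "?At *\<^sub>v u \<in> carrier_vec n"
    using A x z b u by auto
  have summand: "(eucl_norm (?a j))\<^sup>2 / ?F * ((A *\<^sub>v rgs_step A b j x - A *\<^sub>v z) \<bullet> u)
      = (eucl_norm (?a j))\<^sup>2 / ?F * ?r - (?a j \<bullet> ?w) * (?a j \<bullet> u) / ?F" if "j < n" for j
  proof (cases "eucl_norm (?a j) = 0")
    case True
    \<comment> \<open>The weight is zero here, so nothing cancels; but a zero column contributes nothing to the sum
      of the corrections either.\<close>
    have "?a j \<bullet> ?a j = 0"
      using True by (simp add: eucl_norm_def)
    then have "?a j = 0\<^sub>v m"
      using A by (metis carrier_matD(1) carrier_vecI col_dim conjugate_square_eq_0_vec
          vec_conjugate_real)
    then show ?thesis using True u by simp
  next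
    case False
    then show ?thesis
      unfolding rgs_step_residual_component[OF A x Az u that]
      by (simp add: right_diff_distrib)
  qed
  have "(\<Sum>j<n. (?a j \<bullet> ?w) * (?a j \<bullet> u)) = (?At *\<^sub>v ?w) \<bullet> (?At *\<^sub>v u)"
    using A unfolding scalar_prod_def[of "_ *\<^sub>v _"]
    by (auto intro!: sum.cong simp: lessThan_atLeast0)
  also have "?At *\<^sub>v ?w = ?At *\<^sub>v (A *\<^sub>v x - A *\<^sub>v z)"
    using mult_minus_distrib_mat_vec[OF At] Ax Az b normal by simp
  also have "\<dots> \<bullet> (?At *\<^sub>v u) = (A *\<^sub>v x - A *\<^sub>v z) \<bullet> (A *\<^sub>v (?At *\<^sub>v u))"
    using Ax Az by (intro transpose_vec_mult_scalar[OF A Atu]) auto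
  also have "\<dots> = c * ?r"
    using Ax Az u unfolding eigen by (intro scalar_prod_smult_distrib[where n=m]) auto
  finally have gram: "(\<Sum>j<n. (?a j \<bullet> ?w) * (?a j \<bullet> u)) = c * ?r" .
  have "(\<Sum>j<n. (eucl_norm (?a j))\<^sup>2 / ?F * ((A *\<^sub>v rgs_step A b j x - A *\<^sub>v z) \<bullet> u))
      = (\<Sum>j<n. (eucl_norm (?a j))\<^sup>2 / ?F * ?r - (?a j \<bullet> ?w) * (?a j \<bullet> u) / ?F)"
    using summand by (intro sum.cong) auto
  also have "\<dots> = (\<Sum>j<n. (eucl_norm (?a j))\<^sup>2 / ?F) * ?r
      - (\<Sum>j<n. (?a j \<bullet> ?w) * (?a j \<bullet> u)) / ?F"
    by (simp add: sum_subtractf sum_distrib_right sum_divide_distrib)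
  also have "\<dots> = (1 - c / ?F) * ?r"
    unfolding prob gram by (simp add: algebra_simps)
  finally show ?thesis .
qed

section \<open>Averaging over an independent selection\<close>

text \<open>Conditioning on \<open>X\<close> and averaging over an independent variable, by linearity: split according
  to the value of the second variable and factor each expectation. The second variable has the form
  \<open>h \<circ> Z\<close> because two independent random variables have to take their values in the same type.\<close>

lemma (in prob_space) expectation_indep_finite:
  fixes f :: "'s \<Rightarrow> 't \<Rightarrow> real"
  assumes indep: "indep_var (count_space B) X N Z" and h: "h \<in> N \<rightarrow>\<^sub>M count_space C"
    and fin: "finite B" "finite C"
  shows "expectation (\<lambda>\<omega>. f (X \<omega>) (h (Z \<omega>)))
    = expectation (\<lambda>\<omega>. \<Sum>t\<in>C. prob {\<omega> \<in> space M. h (Z \<omega>) = t} * f (X \<omega>) t)"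
proof -
  define Y where "Y = (\<lambda>\<omega>. h (Z \<omega>))"
  have X: "X \<in> M \<rightarrow>\<^sub>M count_space B" and Y: "Y \<in> M \<rightarrow>\<^sub>M count_space C"
    using indep_var_rv1[OF indep] measurable_compose[OF indep_var_rv2[OF indep] h]
    by (simp_all add: Y_def)
  have XB: "X \<omega> \<in> B" and YC: "Y \<omega> \<in> C" if "\<omega> \<in> space M" for \<omega>
    using measurable_space[OF X that] measurable_space[OF Y that] by auto
  have intX: "integrable M (\<lambda>\<omega>. g (X \<omega>))" for g :: "'s \<Rightarrow> real"
  proof (rule integrable_const_bound[where B = "\<Sum>s\<in>B. \<bar>g s\<bar>"])
    show "AE \<omega> in M. norm (g (X \<omega>)) \<le> (\<Sum>s\<in>B. \<bar>g s\<bar>)"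
      using fin XB by (auto intro!: AE_I2 member_le_sum[where f = "\<lambda>s. \<bar>g s\<bar>"])
    show "(\<lambda>\<omega>. g (X \<omega>)) \<in> borel_measurable M"
      by (rule measurable_compose[OF X]) simp
  qed
  have intY: "integrable M (\<lambda>\<omega>. indicat_real {t} (Y \<omega>))" for t
    by (rule integrable_const_bound[where B = 1])
       (auto intro!: measurable_compose[OF Y] simp: indicator_def)
  have expY: "expectation (\<lambda>\<omega>. indicat_real {t} (Y \<omega>)) = prob {\<omega> \<in> space M. Y \<omega> = t}" for t
  proof -
    have "expectation (\<lambda>\<omega>. indicat_real {t} (Y \<omega>))
        = expectation (indicat_real {\<omega> \<in> space M. Y \<omega> = t})"
      by (rule Bochner_Integration.integral_cong) (auto simp: indicator_def)
    also have "\<dots> = prob ({\<omega> \<in> space M. Y \<omega> = t} \<inter> space M)"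
      by simp
    also have "{\<omega> \<in> space M. Y \<omega> = t} \<inter> space M = {\<omega> \<in> space M. Y \<omega> = t}"
      by auto
    finally show ?thesis .
  qed
  have prod_int: "integrable M (\<lambda>\<omega>. indicat_real {t} (Y \<omega>) * f (X \<omega>) t)" (is ?int)
    and prod_exp: "expectation (\<lambda>\<omega>. indicat_real {t} (Y \<omega>) * f (X \<omega>) t)
      = prob {\<omega> \<in> space M. Y \<omega> = t} * expectation (\<lambda>\<omega>. f (X \<omega>) t)" (is ?exp) for t
  proof -
    have "indep_var borel ((\<lambda>s. f s t) \<circ> X) borel ((\<lambda>z. indicat_real {t} (h z)) \<circ> Z)"
      by (rule indep_var_compose[OF indep _ measurable_compose[OF h]]) auto
    then have ind: "indep_var borel (\<lambda>\<omega>. f (X \<omega>) t) borel (\<lambda>\<omega>. indicat_real {t} (Y \<omega>))"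
      by (simp add: o_def Y_def)
    show ?int
      using indep_var_integrable[OF ind intX intY] by (simp add: mult.commute)
    show ?exp
      using indep_var_lebesgue_integral[OF ind intX intY] expY by (simp add: mult.commute)
  qed
  have "expectation (\<lambda>\<omega>. f (X \<omega>) (Y \<omega>))
      = expectation (\<lambda>\<omega>. \<Sum>t\<in>C. indicat_real {t} (Y \<omega>) * f (X \<omega>) t)"
  proof (rule Bochner_Integration.integral_cong[OF refl])
    fix \<omega> assume "\<omega> \<in> space M"
    have "(\<Sum>t\<in>C. indicat_real {t} (Y \<omega>) * f (X \<omega>) t)
        = (\<Sum>t\<in>C. if t = Y \<omega> then f (X \<omega>) t else 0)"
      by (rule sum.cong) (auto simp: indicator_def)
    then show "f (X \<omega>) (Y \<omega>) = (\<Sum>t\<in>C. indicat_real {t} (Y \<omega>) * f (X \<omega>) t)"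
      using fin(2) YC[OF \<open>\<omega> \<in> space M\<close>] by simp
  qed
  also have "\<dots> = (\<Sum>t\<in>C. prob {\<omega> \<in> space M. Y \<omega> = t} * expectation (\<lambda>\<omega>. f (X \<omega>) t))"
    using prod_int by (simp add: prod_exp)
  also have "\<dots> = expectation (\<lambda>\<omega>. \<Sum>t\<in>C. prob {\<omega> \<in> space M. Y \<omega> = t} * f (X \<omega>) t)"
    by (subst Bochner_Integration.integral_sum)
       (auto intro: intX[of "\<lambda>s. f s _"] integrable_mult_right)
  finally show ?thesis by (simp add: Y_def)
qed

context rgs_selection
begin

text \<open>The past is recorded as the tuple of the first \<open>k\<close> selections. It ranges over a
  finite set with the discrete measurable structure, on which every function is measurable and
  bounded.\<close>

lemma expectation_next:
  fixes f :: "(nat \<Rightarrow> nat) \<Rightarrow> nat \<Rightarrow> real"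
  shows "expectation (\<lambda>\<omega>. f (\<lambda>i\<in>{1..k}. J i \<omega>) (J (Suc k) \<omega>))
    = expectation (\<lambda>\<omega>. \<Sum>j<dim_col A.
        (eucl_norm (col A j))\<^sup>2 / (frob_norm A)\<^sup>2 * f (\<lambda>i\<in>{1..k}. J i \<omega>) j)"
proof -
  let ?C = "count_space {..<dim_col A}"
  have "indep_var (PiM {1..k} (\<lambda>_. ?C)) (\<lambda>\<omega>. \<lambda>i\<in>{1..k}. J i \<omega>)
      (PiM {Suc k} (\<lambda>_. ?C)) (\<lambda>\<omega>. \<lambda>i\<in>{Suc k}. J i \<omega>)"
    by (rule indep_var_restrict[OF indep]) auto
  then have "indep_var (count_space ({1..k} \<rightarrow>\<^sub>E {..<dim_col A})) (\<lambda>\<omega>. \<lambda>i\<in>{1..k}. J i \<omega>)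
      (PiM {Suc k} (\<lambda>_. ?C)) (\<lambda>\<omega>. \<lambda>i\<in>{Suc k}. J i \<omega>)"
    by (simp add: count_space_PiM_finite)
  moreover have "(\<lambda>g. g (Suc k)) \<in> PiM {Suc k} (\<lambda>_. ?C) \<rightarrow>\<^sub>M ?C"
    by (rule measurable_component_singleton) simp
  moreover have "finite ({1..k} \<rightarrow>\<^sub>E {..<dim_col A})"
    by (auto intro: finite_PiE)
  ultimately have "expectation (\<lambda>\<omega>. f (\<lambda>i\<in>{1..k}. J i \<omega>) ((\<lambda>i\<in>{Suc k}. J i \<omega>) (Suc k)))
      = expectation (\<lambda>\<omega>. \<Sum>j<dim_col A.
          prob {\<omega> \<in> space M. (\<lambda>i\<in>{Suc k}. J i \<omega>) (Suc k) = j} * f (\<lambda>i\<in>{1..k}. J i \<omega>) j)"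
    by (rule expectation_indep_finite) simp
  then show ?thesis
    by (simp add: prob_select)
qed

lemma sum_selection_probabilities:
  "(\<Sum>j<dim_col A. (eucl_norm (col A j))\<^sup>2 / (frob_norm A)\<^sup>2) = 1"
  using expectation_next[of "\<lambda>_ _. 1" 0] prob_space by simp

end

theorem theorem2:
  fixes A U S V :: "real mat" and b x0 xstar :: "real vec" and m n k l :: nat
    and M :: "'a measure" and J :: "nat \<Rightarrow> 'a \<Rightarrow> nat"
  assumes "A \<in> carrier_mat m n"
    and "vec_space.rank m A = n"
    and "b \<in> carrier_vec m"
    and "xstar = pinv A *\<^sub>v b"
    and "is_svd A U S V"
    and "x0 \<in> carrier_vec n"
    and "rgs_selection M A J"
    and "l < min m n"
  shows "prob_space.expectation M
           (\<lambda>\<omega>. (A *\<^sub>v rgs A b x0 (\<lambda>i. J i \<omega>) k - A *\<^sub>v xstar) \<bullet> col U l)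
         = (1 - (S $$ (l, l))\<^sup>2 / (frob_norm A)\<^sup>2) ^ k * ((A *\<^sub>v x0 - A *\<^sub>v xstar) \<bullet> col U l)"
proof -
  interpret rgs_selection M A J by fact
  note A = assms(1) and b = assms(3) and svd = assms(5) and x0 = assms(6)
  have l: "l < m" "l < n" and u: "col U l \<in> carrier_vec m" and dim: "dim_col A = n"
    using assms(8) A is_svdD(1)[OF svd A] by auto
  have pinv: "is_pinv A (pinv A)"
    using is_svd_imp_ex_pinv[OF svd] is_pinv_pinv by blast
  then have xstar: "xstar \<in> carrier_vec n"
    using A b assms(4) by (auto simp: is_pinv_def)
  have normal: "transpose_mat A *\<^sub>v (A *\<^sub>v xstar) = transpose_mat A *\<^sub>v b"
    unfolding assms(4) by (rule is_pinv_normal_equations[OF A pinv b])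
  note average = rgs_step_average[OF A b _ xstar u normal
      is_svd_left_singular_vector_eigen[OF svd A l] sum_selection_probabilities[unfolded dim]]
  let ?q = "1 - (S $$ (l, l))\<^sup>2 / (frob_norm A)\<^sup>2"
  show ?thesis
  proof (induction k)
    case 0
    show ?case by (simp add: prob_space)
  next
    case (Suc k)
    let ?J = "\<lambda>\<omega>. \<lambda>i\<in>{1..k}. J i \<omega>"
    \<comment> \<open>The iterate depends only on the recorded past, which is what allows averaging over the next
      selection separately.\<close>
    have past: "rgs A b x0 (\<lambda>i. J i \<omega>) k = rgs A b x0 (?J \<omega>) k" for \<omega>
      by (rule rgs_cong) simp
    have "expectation (\<lambda>\<omega>. (A *\<^sub>v rgs A b x0 (\<lambda>i. J i \<omega>) (Suc k) - A *\<^sub>v xstar) \<bullet> col U l)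
        = expectation (\<lambda>\<omega>.
            (A *\<^sub>v rgs_step A b (J (Suc k) \<omega>) (rgs A b x0 (?J \<omega>) k) - A *\<^sub>v xstar) \<bullet> col U l)"
      by (simp only: rgs.simps past)
    also have "\<dots> = expectation (\<lambda>\<omega>.
        ?q * ((A *\<^sub>v rgs A b x0 (\<lambda>i. J i \<omega>) k - A *\<^sub>v xstar) \<bullet> col U l))"
      unfolding past
      by (subst expectation_next[of "\<lambda>f j. (A *\<^sub>v rgs_step A b j (rgs A b x0 f k) - A *\<^sub>v xstar) \<bullet> col U l"])
         (simp only: dim average[OF rgs_carrier[OF A x0]])
    also have "\<dots> = ?q * expectation (\<lambda>\<omega>.
        (A *\<^sub>v rgs A b x0 (\<lambda>i. J i \<omega>) k - A *\<^sub>v xstar) \<bullet> col U l)"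
      by simp
    finally show ?case
      by (simp only: Suc.IH power_Suc mult.assoc)
  qed
qed

end
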